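(* Let $(M,\Pi,D)$ be an exact Poisson manifold and let $\Phi:\mathbb{R}^+\times M\to M$ be a conformally Poisson action of degree $c\in\mathbb{R}$. Let $J:M\to\mathbb{R}$ be a conformal momentum map of degree $c$ for this action. Let $H\in C^\infty(M)$ be a Hamiltonian that is conformally invariant (of some degree $b\in\mathbb{R}$) under $\Phi$. For $\xi\in\mathbb{R}$ put $H_\xi=H-J_\xi$ (the augmented Hamiltonian) and define the vector field $$X_{H,\xi}^{\mathrm{conf}}:=\Pi^\sharp(dH_\xi)-(c\xi)D.$$ Then a point $z_e\in M$ is a conformal relative equilibrium (of the Hamiltonian vector field $X_H$) if and only if there exists $\xi\in\mathbb{R}$ such that $$X_{H,\xi}^{\mathrm{conf}}(z_e)=0.$$
   Context: $\mathbb{R}^+$ is the multiplicative group of positive reals, with Lie algebra identified with $\mathbb{R}$. An exact Poisson manifold $(M,\Pi,D)$ is a Poisson manifold $(M,\Pi)$ together with a vector field $D$ (the Liouville vector field) such that $\mathcal{L}_D\Pi=-\Pi$. The bundle map $\Pi^\sharp:T^*M\to TM$ is $\Pi^\sharp(\alpha)=\Pi(\alpha,\cdot)$, and the Hamiltonian vector field of $H$ is $X_H=\Pi^\sharp(dH)$. A smooth action $\Phi:\mathbb{R}^+\times M\to M$ is conformally Poisson of degree $c$ if $(\Phi_s)_*\Pi=s^c\Pi$ for all $s\in\mathbb{R}^+$. $H$ is conformally invariant of degree $b$ if $\Phi_s^*H=s^bH$ for all $s\in\mathbb{R}^+$. For $\xi\in\mathbb{R}$ the infinitesimal generator is $\xi_M(x)=\frac{d}{dt}\big|_{t=0}\Phi_{e^{t\xi}}(x)$.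 A conformal momentum map of degree $c$ is a smooth map $J:M\to\mathbb{R}$ such that $\xi_M=\Pi^\sharp(dJ_\xi)+(c\xi)D$ for every $\xi\in\mathbb{R}$, where $J_\xi=\xi J$. A point $z_e\in M$ is a conformal relative equilibrium of $X_H$ if there exists $\xi\in\mathbb{R}$ such that $X_H(z_e)=\xi_M(z_e)$. *)

theory Defs
  imports "HOL-Analysis.Analysis"
begin

section \<open>Smooth manifolds\<close>

text \<open>
  \<open>C\<^sup>k\<close> maps on an open subset of a finite-dimensional space.  Differentiability implies continuity,
  and in finite dimension \<open>x \<mapsto> Df(x)\<close> is \<open>C\<^sup>k\<close> iff \<open>x \<mapsto> Df(x)v\<close> is \<open>C\<^sup>k\<close> for every \<open>v\<close>.
\<close>

primrec Ck_on ::
  "nat \<Rightarrow> 'a::real_normed_vector set \<Rightarrow> ('a \<Rightarrow> 'b::real_normed_vector) \<Rightarrow> bool" where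
  "Ck_on 0 S f \<longleftrightarrow> continuous_on S f"
| "Ck_on (Suc k) S f \<longleftrightarrow>
     (\<forall>x\<in>S. f differentiable (at x)) \<and> (\<forall>v. Ck_on k S (\<lambda>x. frechet_derivative f (at x) v))"

definition smooth_on :: "'a::real_normed_vector set \<Rightarrow> ('a \<Rightarrow> 'b::real_normed_vector) \<Rightarrow> bool" where
  "smooth_on S f \<longleftrightarrow> (\<forall>k. Ck_on k S f)"

text \<open>
  A chart is a pair \<open>(U, \<phi>)\<close>; only the restriction of \<open>\<phi>\<close> to \<open>U\<close> matters.  The underlying set of the
  manifold is the carrier of its topology.
\<close>

record ('m, 'e) mfd =
  mtop :: "'m topology"
  charts :: "('m set \<times> ('m \<Rightarrow> 'e)) set"

abbreviation points :: "('m, 'e) mfd \<Rightarrow> 'm set" where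
  "points M \<equiv> topspace (mtop M)"

text \<open>
  The model space is a finite-dimensional normed space rather than a type of class
  \<open>euclidean_space\<close>, as the latter excludes dimension \<open>0\<close>.
\<close>

definition smooth_manifold :: "('m, 'e::real_normed_vector) mfd \<Rightarrow> bool" where
  "smooth_manifold M \<longleftrightarrow>
     (\<exists>B :: 'e set. finite B \<and> span B = UNIV) \<and>
     Hausdorff_space (mtop M) \<and> second_countable (mtop M) \<and>
     (\<Union>(U, \<phi>)\<in>charts M. U) = points M \<and>
     (\<forall>(U, \<phi>)\<in>charts M. openin (mtop M) U \<and> open (\<phi> ` U) \<and>
        homeomorphic_map (subtopology (mtop M) U) (top_of_set (\<phi> ` U)) \<phi>) \<and>
     (\<forall>(U, \<phi>)\<in>charts M. \<forall>(V, \<psi>)\<in>charts M.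
        smooth_on (\<phi> ` (U \<inter> V)) (\<psi> \<circ> inv_into U \<phi>))"

definition smooth_map ::
  "('m, 'e::real_normed_vector) mfd \<Rightarrow> ('n, 'f::real_normed_vector) mfd \<Rightarrow> ('m \<Rightarrow> 'n) \<Rightarrow> bool" where
  "smooth_map M N F \<longleftrightarrow>
     continuous_map (mtop M) (mtop N) F \<and>
     (\<forall>(U, \<phi>)\<in>charts M. \<forall>(V, \<psi>)\<in>charts N.
        smooth_on (\<phi> ` {x \<in> U. F x \<in> V}) (\<psi> \<circ> F \<circ> inv_into U \<phi>))"

definition real_mfd :: "(real, real) mfd" where
  "real_mfd = \<lparr>mtop = euclidean, charts = {(UNIV, id)}\<rparr>"

definition pos_real_mfd :: "(real, real) mfd" where
  "pos_real_mfd = \<lparr>mtop = top_of_set {0<..}, charts = {({0<..}, id)}\<rparr>"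

definition prod_mfd :: "('m, 'e) mfd \<Rightarrow> ('n, 'f) mfd \<Rightarrow> ('m \<times> 'n, 'e \<times> 'f) mfd" where
  "prod_mfd M N =
     \<lparr>mtop = prod_topology (mtop M) (mtop N),
      charts = {(U \<times> V, map_prod \<phi> \<psi>) | U \<phi> V \<psi>. (U, \<phi>) \<in> charts M \<and> (V, \<psi>) \<in> charts N}\<rparr>"

definition smooth_funs :: "('m, 'e::real_normed_vector) mfd \<Rightarrow> ('m \<Rightarrow> real) set" where
  "smooth_funs M = {f. smooth_map M real_mfd f}"


section \<open>Tangent and cotangent spaces, vector fields, one-forms\<close>

text \<open>
  Tangent vectors at \<open>p\<close> are the derivations of \<open>C\<^sup>\<infinity>(M)\<close> at \<open>p\<close>, set to \<open>0\<close> on functions that are not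
  smooth, so that equality of tangent vectors is equality in the logic.  Values of functions off
  the carrier are irrelevant: if \<open>h\<close> vanishes on \<open>M\<close> then \<open>h = h * \<chi>\<close>, where \<open>\<chi>\<close> is the indicator of
  the complement of \<open>M\<close>, so the product rule yields \<open>X h = 0\<close>.
\<close>

type_synonym 'm tvec = "('m \<Rightarrow> real) \<Rightarrow> real"
type_synonym 'm cvec = "'m tvec \<Rightarrow> real"
type_synonym 'm bivec = "'m cvec \<Rightarrow> 'm cvec \<Rightarrow> real"

definition tangent_space :: "('m, 'e::real_normed_vector) mfd \<Rightarrow> 'm \<Rightarrow> 'm tvec set" where
  "tangent_space M p = {X.
     (\<forall>f\<in>smooth_funs M. \<forall>g\<in>smooth_funs M. X (\<lambda>x. f x + g x) = X f + X g) \<and>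
     (\<forall>a. \<forall>f\<in>smooth_funs M. X (\<lambda>x. a * f x) = a * X f) \<and>
     (\<forall>f\<in>smooth_funs M. \<forall>g\<in>smooth_funs M. X (\<lambda>x. f x * g x) = f p * X g + g p * X f) \<and>
     (\<forall>f. f \<notin> smooth_funs M \<longrightarrow> X f = 0)}"

definition cotangent_space :: "('m, 'e::real_normed_vector) mfd \<Rightarrow> 'm \<Rightarrow> 'm cvec set" where
  "cotangent_space M p = {\<alpha>.
     (\<forall>X\<in>tangent_space M p. \<forall>Y\<in>tangent_space M p. \<alpha> (\<lambda>f. X f + Y f) = \<alpha> X + \<alpha> Y) \<and>
     (\<forall>a. \<forall>X\<in>tangent_space M p. \<alpha> (\<lambda>f. a * X f) = a * \<alpha> X) \<and>
     (\<forall>X. X \<notin> tangent_space M p \<longrightarrow> \<alpha> X = 0)}"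

definition differential ::
  "('m, 'e::real_normed_vector) mfd \<Rightarrow> ('m \<Rightarrow> real) \<Rightarrow> 'm \<Rightarrow> 'm cvec" where
  "differential M f p = (\<lambda>X. if X \<in> tangent_space M p then X f else 0)"

definition vector_field :: "('m, 'e::real_normed_vector) mfd \<Rightarrow> ('m \<Rightarrow> 'm tvec) \<Rightarrow> bool" where
  "vector_field M Y \<longleftrightarrow>
     (\<forall>p\<in>points M. Y p \<in> tangent_space M p) \<and>
     (\<forall>f\<in>smooth_funs M. (\<lambda>p. Y p f) \<in> smooth_funs M)"

definition one_form :: "('m, 'e::real_normed_vector) mfd \<Rightarrow> ('m \<Rightarrow> 'm cvec) \<Rightarrow> bool" where
  "one_form M \<alpha> \<longleftrightarrow>
     (\<forall>p\<in>points M. \<alpha> p \<in> cotangent_space M p) \<and>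
     (\<forall>Y. vector_field M Y \<longrightarrow> (\<lambda>p. \<alpha> p (Y p)) \<in> smooth_funs M)"

text \<open>The tangent vector \<open>\<gamma>'(t)\<close> of a curve \<open>\<gamma>\<close> in \<open>M\<close>.\<close>

definition velocity ::
  "('m, 'e::real_normed_vector) mfd \<Rightarrow> (real \<Rightarrow> 'm) \<Rightarrow> real \<Rightarrow> 'm tvec" where
  "velocity M \<gamma> t = (\<lambda>f. if f \<in> smooth_funs M then deriv (\<lambda>u. f (\<gamma> u)) t else 0)"

definition tangent_map ::
  "('n, 'f::real_normed_vector) mfd \<Rightarrow> ('m \<Rightarrow> 'n) \<Rightarrow> 'm tvec \<Rightarrow> 'n tvec" where
  "tangent_map N F X = (\<lambda>f. if f \<in> smooth_funs N then X (f \<circ> F) else 0)"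

text \<open>The pullback of covectors at \<open>F p\<close> to covectors at \<open>p\<close>.\<close>

definition cotangent_map ::
  "('m, 'e::real_normed_vector) mfd \<Rightarrow> ('n, 'f::real_normed_vector) mfd \<Rightarrow> ('m \<Rightarrow> 'n) \<Rightarrow> 'm
    \<Rightarrow> 'n cvec \<Rightarrow> 'm cvec" where
  "cotangent_map M N F p \<alpha> =
     (\<lambda>X. if X \<in> tangent_space M p then \<alpha> (tangent_map N F X) else 0)"


section \<open>Lie derivatives\<close>

definition lie_bracket ::
  "('m, 'e::real_normed_vector) mfd \<Rightarrow> ('m \<Rightarrow> 'm tvec) \<Rightarrow> ('m \<Rightarrow> 'm tvec) \<Rightarrow> 'm \<Rightarrow> 'm tvec" where
  "lie_bracket M D Y p =
     (\<lambda>f. if f \<in> smooth_funs M then D p (\<lambda>q. Y q f) - Y p (\<lambda>q. D q f) else 0)"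

text \<open>
  \<open>(L\<^sub>D \<alpha>)(Y) = D(\<alpha>(Y)) - \<alpha>([D,Y])\<close>; the right-hand side at \<open>p\<close> depends on the vector field \<open>Y\<close> only
  through \<open>Y(p)\<close>, so any extension of the tangent vector to a vector field may be chosen.
\<close>

definition lie_one_form ::
  "('m, 'e::real_normed_vector) mfd \<Rightarrow> ('m \<Rightarrow> 'm tvec) \<Rightarrow> ('m \<Rightarrow> 'm cvec) \<Rightarrow> 'm \<Rightarrow> 'm cvec" where
  "lie_one_form M D \<alpha> p =
     (\<lambda>X. if X \<in> tangent_space M p
          then let Y = (SOME Y. vector_field M Y \<and> Y p = X)
               in D p (\<lambda>q. \<alpha> q (Y q)) - \<alpha> p (lie_bracket M D Y p)
          else 0)"

text \<open>
  \<open>(L\<^sub>D \<pi>)(\<alpha>,\<beta>) = D(\<pi>(\<alpha>,\<beta>)) - \<pi>(L\<^sub>D \<alpha>, \<beta>) - \<pi>(\<alpha>, L\<^sub>D \<beta>)\<close>.  The arguments \<open>\<alpha>\<close>, \<open>\<beta>\<close> are one-forms; the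
  bivector field \<open>L\<^sub>D \<pi>\<close> is determined by its values on them.
\<close>

definition lie_bivector ::
  "('m, 'e::real_normed_vector) mfd \<Rightarrow> ('m \<Rightarrow> 'm tvec) \<Rightarrow> ('m \<Rightarrow> 'm bivec)
    \<Rightarrow> ('m \<Rightarrow> 'm cvec) \<Rightarrow> ('m \<Rightarrow> 'm cvec) \<Rightarrow> 'm \<Rightarrow> real" where
  "lie_bivector M D \<pi> \<alpha> \<beta> p =
     D p (\<lambda>q. \<pi> q (\<alpha> q) (\<beta> q)) - \<pi> p (lie_one_form M D \<alpha> p) (\<beta> p) - \<pi> p (\<alpha> p) (lie_one_form M D \<beta> p)"


section \<open>Poisson manifolds\<close>

text \<open>
  The bivector is written \<open>\<pi>\<close>, as the capital letter is reserved for dependent function spaces.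
  Linearity in the second argument follows from antisymmetry.
\<close>

definition bivector_field :: "('m, 'e::real_normed_vector) mfd \<Rightarrow> ('m \<Rightarrow> 'm bivec) \<Rightarrow> bool" where
  "bivector_field M \<pi> \<longleftrightarrow>
     (\<forall>p\<in>points M. \<forall>\<alpha>\<in>cotangent_space M p. \<forall>\<beta>\<in>cotangent_space M p.
        \<pi> p \<beta> \<alpha> = - \<pi> p \<alpha> \<beta> \<and>
        (\<forall>a. \<pi> p (\<lambda>X. a * \<alpha> X) \<beta> = a * \<pi> p \<alpha> \<beta>) \<and>
        (\<forall>\<alpha>'\<in>cotangent_space M p. \<pi> p (\<lambda>X. \<alpha> X + \<alpha>' X) \<beta> = \<pi> p \<alpha> \<beta> + \<pi> p \<alpha>' \<beta>)) \<and>
     (\<forall>\<alpha> \<beta>. one_form M \<alpha> \<longrightarrow> one_form M \<beta> \<longrightarrow> (\<lambda>p. \<pi> p (\<alpha> p) (\<beta> p)) \<in> smooth_funs M)"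

definition poisson_bracket ::
  "('m, 'e::real_normed_vector) mfd \<Rightarrow> ('m \<Rightarrow> 'm bivec) \<Rightarrow> ('m \<Rightarrow> real) \<Rightarrow> ('m \<Rightarrow> real) \<Rightarrow> 'm \<Rightarrow> real" where
  "poisson_bracket M \<pi> f g p = \<pi> p (differential M f p) (differential M g p)"

definition poisson_manifold :: "('m, 'e::real_normed_vector) mfd \<Rightarrow> ('m \<Rightarrow> 'm bivec) \<Rightarrow> bool" where
  "poisson_manifold M \<pi> \<longleftrightarrow>
     smooth_manifold M \<and> bivector_field M \<pi> \<and>
     (\<forall>f\<in>smooth_funs M. \<forall>g\<in>smooth_funs M. \<forall>h\<in>smooth_funs M. \<forall>p\<in>points M.
        poisson_bracket M \<pi> f (poisson_bracket M \<pi> g h) p +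
        poisson_bracket M \<pi> g (poisson_bracket M \<pi> h f) p +
        poisson_bracket M \<pi> h (poisson_bracket M \<pi> f g) p = 0)"

definition exact_poisson_manifold ::
  "('m, 'e::real_normed_vector) mfd \<Rightarrow> ('m \<Rightarrow> 'm bivec) \<Rightarrow> ('m \<Rightarrow> 'm tvec) \<Rightarrow> bool" where
  "exact_poisson_manifold M \<pi> D \<longleftrightarrow>
     poisson_manifold M \<pi> \<and> vector_field M D \<and>
     (\<forall>\<alpha> \<beta>. one_form M \<alpha> \<longrightarrow> one_form M \<beta> \<longrightarrow>
        (\<forall>p\<in>points M. lie_bivector M D \<pi> \<alpha> \<beta> p = - \<pi> p (\<alpha> p) (\<beta> p)))"

text \<open>
  \<open>\<pi>\<^sup>\<sharp>(\<alpha>) = \<pi>(\<alpha>, \<cdot>)\<close> is a functional on \<open>T\<^sup>*\<^sub>p M\<close>; the tangent vector \<open>X\<close> identified with it satisfies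
  \<open>X f = df(X) = \<pi>(\<alpha>, df)\<close>.
\<close>

definition sharp ::
  "('m, 'e::real_normed_vector) mfd \<Rightarrow> ('m \<Rightarrow> 'm bivec) \<Rightarrow> 'm \<Rightarrow> 'm cvec \<Rightarrow> 'm tvec" where
  "sharp M \<pi> p \<alpha> = (\<lambda>f. if f \<in> smooth_funs M then \<pi> p \<alpha> (differential M f p) else 0)"

definition hamiltonian_vf ::
  "('m, 'e::real_normed_vector) mfd \<Rightarrow> ('m \<Rightarrow> 'm bivec) \<Rightarrow> ('m \<Rightarrow> real) \<Rightarrow> 'm \<Rightarrow> 'm tvec" where
  "hamiltonian_vf M \<pi> H p = sharp M \<pi> p (differential M H p)"

definition pushforward_bivector ::
  "('m, 'e::real_normed_vector) mfd \<Rightarrow> ('m \<Rightarrow> 'm) \<Rightarrow> ('m \<Rightarrow> 'm bivec) \<Rightarrow> 'm \<Rightarrow> 'm bivec" where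
  "pushforward_bivector M F \<pi> y \<alpha> \<beta> =
     (let x = inv_into (points M) F y
      in \<pi> x (cotangent_map M M F x \<alpha>) (cotangent_map M M F x \<beta>))"


section \<open>Conformal actions of the positive reals\<close>

definition smooth_action :: "('m, 'e::real_normed_vector) mfd \<Rightarrow> (real \<Rightarrow> 'm \<Rightarrow> 'm) \<Rightarrow> bool" where
  "smooth_action M \<Phi> \<longleftrightarrow>
     smooth_map (prod_mfd pos_real_mfd M) M (\<lambda>(s, x). \<Phi> s x) \<and>
     (\<forall>x\<in>points M. \<Phi> 1 x = x) \<and>
     (\<forall>s>0. \<forall>t>0. \<forall>x\<in>points M. \<Phi> (s * t) x = \<Phi> s (\<Phi> t x))"

definition conformally_poisson ::
  "('m, 'e::real_normed_vector) mfd \<Rightarrow> ('m \<Rightarrow> 'm bivec) \<Rightarrow> (real \<Rightarrow> 'm \<Rightarrow> 'm) \<Rightarrow> real \<Rightarrow> bool" where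
  "conformally_poisson M \<pi> \<Phi> c \<longleftrightarrow>
     smooth_action M \<Phi> \<and>
     (\<forall>s>0. \<forall>y\<in>points M. \<forall>\<alpha>\<in>cotangent_space M y. \<forall>\<beta>\<in>cotangent_space M y.
        pushforward_bivector M (\<Phi> s) \<pi> y \<alpha> \<beta> = s powr c * \<pi> y \<alpha> \<beta>)"

definition conformally_invariant ::
  "('m, 'e::real_normed_vector) mfd \<Rightarrow> (real \<Rightarrow> 'm \<Rightarrow> 'm) \<Rightarrow> ('m \<Rightarrow> real) \<Rightarrow> real \<Rightarrow> bool" where
  "conformally_invariant M \<Phi> H b \<longleftrightarrow> (\<forall>s>0. \<forall>x\<in>points M. H (\<Phi> s x) = s powr b * H x)"

definition infinitesimal_generator ::
  "('m, 'e::real_normed_vector) mfd \<Rightarrow> (real \<Rightarrow> 'm \<Rightarrow> 'm) \<Rightarrow> real \<Rightarrow> 'm \<Rightarrow> 'm tvec" where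
  "infinitesimal_generator M \<Phi> \<xi> x = velocity M (\<lambda>t. \<Phi> (exp (t * \<xi>)) x) 0"

definition momentum_component :: "('m \<Rightarrow> real) \<Rightarrow> real \<Rightarrow> 'm \<Rightarrow> real" where
  "momentum_component J \<xi> = (\<lambda>x. \<xi> * J x)"

definition conformal_momentum_map ::
  "('m, 'e::real_normed_vector) mfd \<Rightarrow> ('m \<Rightarrow> 'm bivec) \<Rightarrow> ('m \<Rightarrow> 'm tvec) \<Rightarrow> (real \<Rightarrow> 'm \<Rightarrow> 'm)
    \<Rightarrow> real \<Rightarrow> ('m \<Rightarrow> real) \<Rightarrow> bool" where
  "conformal_momentum_map M \<pi> D \<Phi> c J \<longleftrightarrow>
     J \<in> smooth_funs M \<and>
     (\<forall>\<xi>. \<forall>x\<in>points M. infinitesimal_generator M \<Phi> \<xi> x =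
        (\<lambda>f. sharp M \<pi> x (differential M (momentum_component J \<xi>) x) f + (c * \<xi>) * D x f))"

definition conformal_relative_equilibrium ::
  "('m, 'e::real_normed_vector) mfd \<Rightarrow> ('m \<Rightarrow> 'm bivec) \<Rightarrow> (real \<Rightarrow> 'm \<Rightarrow> 'm) \<Rightarrow> ('m \<Rightarrow> real)
    \<Rightarrow> 'm \<Rightarrow> bool" where
  "conformal_relative_equilibrium M \<pi> \<Phi> H z \<longleftrightarrow>
     (\<exists>\<xi>. hamiltonian_vf M \<pi> H z = infinitesimal_generator M \<Phi> \<xi> z)"

definition augmented_hamiltonian :: "('m \<Rightarrow> real) \<Rightarrow> ('m \<Rightarrow> real) \<Rightarrow> real \<Rightarrow> 'm \<Rightarrow> real" where
  "augmented_hamiltonian H J \<xi> = (\<lambda>x. H x - momentum_component J \<xi> x)"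

definition conf_hamiltonian_vf ::
  "('m, 'e::real_normed_vector) mfd \<Rightarrow> ('m \<Rightarrow> 'm bivec) \<Rightarrow> ('m \<Rightarrow> 'm tvec) \<Rightarrow> real
    \<Rightarrow> ('m \<Rightarrow> real) \<Rightarrow> ('m \<Rightarrow> real) \<Rightarrow> real \<Rightarrow> 'm \<Rightarrow> 'm tvec" where
  "conf_hamiltonian_vf M \<pi> D c J H \<xi> x =
     (\<lambda>f. sharp M \<pi> x (differential M (augmented_hamiltonian H J \<xi>) x) f - (c * \<xi>) * D x f)"

end

theory Submission
  imports Defs
begin

text \<open>Both the differential and \<pi>\<sharp> are linear, so \<pi>\<sharp>(dH_\<xi>) = X_H -
  \<pi>\<sharp>(dJ_\<xi>), which is \<open>sharp_augmented_hamiltonian\<close>. Subtracting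
  (c\<xi>)D and using the momentum map equation \<xi>_M = \<pi>\<sharp>(dJ_\<xi>) + (c\<xi>)D shows
  that the conformal field is X_H - \<xi>_M on all of M. It vanishes at a point exactly when X_H and
  \<xi>_M agree there, with the same \<xi> on both sides. The remaining work is to justify linearity
  for tangent vectors encoded as derivations. These are linear only on smooth functions, so \<xi>J
  must be shown smooth (\<open>smooth_funs_cmult\<close>); bivectors are linear only on genuine
  covectors, so differentials must be shown to be such.\<close>

text \<open>On an open set the derivative at a point depends only on nearby values, so agreement on
  \<open>S\<close> passes to all derivatives by induction on \<open>k\<close>.\<close>

lemma Ck_on_cong:
  assumes "open S" and "\<And>x. x \<in> S \<Longrightarrow> f x = g x" and "Ck_on k S f"
  shows "Ck_on k S g"
  using assms(2,3)
proof (induction k arbitrary: f g)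
  case 0
  then show ?case by (simp cong: continuous_on_cong)
next
  case (Suc k)
  have hd: "(g has_derivative F) (at x) \<longleftrightarrow> (f has_derivative F) (at x)" if "x \<in> S" for x F
    using has_derivative_transform_within_open[OF _ \<open>open S\<close> that] Suc.prems(1) by metis
  then have "frechet_derivative f (at x) = frechet_derivative g (at x)" if "x \<in> S" for x
    using that by (simp add: frechet_derivative_def)
  then have "Ck_on k S (\<lambda>x. frechet_derivative g (at x) v)" for v
    using Suc.IH[of "\<lambda>x. frechet_derivative f (at x) v"] Suc.prems(2) by simp
  then show ?case using Suc.prems(2) hd by (simp add: differentiable_def)
qed

lemma Ck_on_cmult:
  fixes f :: "'a::real_normed_vector \<Rightarrow> real"
  assumes "open S" and "Ck_on k S f"
  shows "Ck_on k S (\<lambda>x. a * f x)"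
  using assms(2)
proof (induction k arbitrary: f)
  case 0
  then show ?case by (simp add: continuous_on_mult_left)
next
  case (Suc k)
  have hd: "((\<lambda>x. a * f x) has_derivative (\<lambda>v. a * frechet_derivative f (at x) v)) (at x)"
    if "x \<in> S" for x
    using that Suc.prems by (intro has_derivative_mult_right) (simp add: frechet_derivative_works)
  \<comment> \<open>The formula for the derivative of the multiple is available only at points of
    \<open>S\<close>, so the two functions are compared by \<open>Ck_on_cong\<close> instead of
    being rewritten as equal.\<close>
  have "Ck_on k S (\<lambda>x. frechet_derivative (\<lambda>x. a * f x) (at x) v)" for v
  proof (rule Ck_on_cong[OF \<open>open S\<close>])
    show "Ck_on k S (\<lambda>x. a * frechet_derivative f (at x) v)"
      using Suc by simp
    show "a * frechet_derivative f (at x) v = frechet_derivative (\<lambda>x. a * f x) (at x) v"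
      if "x \<in> S" for x
      using frechet_derivative_at[OF hd[OF that]] by metis
  qed
  then show ?case using hd by (auto simp: differentiable_def)
qed

text \<open>The only chart of the target is the identity of the line, so smoothness reduces to
  \<open>Ck_on_cmult\<close> on each open chart image.\<close>

lemma smooth_funs_cmult:
  assumes "smooth_manifold M" and "f \<in> smooth_funs M"
  shows "(\<lambda>x. a * f x) \<in> smooth_funs M"
proof -
  have "smooth_on (\<phi> ` U) ((\<lambda>x. a * f x) \<circ> inv_into U \<phi>)" if "(U, \<phi>) \<in> charts M" for U \<phi>
  proof -
    have "open (\<phi> ` U)"
      using assms(1) that by (auto simp: smooth_manifold_def)
    moreover have "smooth_on (\<phi> ` U) (f \<circ> inv_into U \<phi>)"
      using assms(2) that by (auto simp: smooth_funs_def smooth_map_def real_mfd_def)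
    ultimately show ?thesis
      by (simp add: smooth_on_def o_def Ck_on_cmult)
  qed
  moreover have "continuous_map (mtop M) euclidean (\<lambda>x. a * f x)"
    using assms(2)
    by (auto simp: smooth_funs_def smooth_map_def real_mfd_def intro: continuous_map_real_mult_left)
  ultimately show ?thesis
    by (auto simp: smooth_funs_def smooth_map_def real_mfd_def)
qed

lemma tangent_space_add:
  "X \<in> tangent_space M p \<Longrightarrow> Y \<in> tangent_space M p \<Longrightarrow> (\<lambda>f. X f + Y f) \<in> tangent_space M p"
  by (simp add: tangent_space_def algebra_simps)

lemma tangent_space_cmult:
  "X \<in> tangent_space M p \<Longrightarrow> (\<lambda>f. a * X f) \<in> tangent_space M p"
  by (simp add: tangent_space_def algebra_simps)

text \<open>Evaluation at a fixed function is linear in the derivation. Closure of the tangent space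
  under sums and multiples keeps the default value 0 from interfering.\<close>

lemma differential_in_cotangent_space: "differential M f p \<in> cotangent_space M p"
  by (simp add: cotangent_space_def differential_def tangent_space_add tangent_space_cmult)

lemma cotangent_space_cmult:
  "\<alpha> \<in> cotangent_space M p \<Longrightarrow> (\<lambda>X. a * \<alpha> X) \<in> cotangent_space M p"
  by (simp add: cotangent_space_def algebra_simps)

text \<open>On tangent vectors this is homogeneity of derivations, which is postulated for smooth
  functions; elsewhere both sides are 0.\<close>

lemma differential_cmult:
  "f \<in> smooth_funs M \<Longrightarrow> differential M (\<lambda>x. a * f x) p = (\<lambda>X. a * differential M f p X)"
  by (rule ext) (simp add: differential_def, simp add: tangent_space_def)

lemma differential_add:
  "f \<in> smooth_funs M \<Longrightarrow> g \<in> smooth_funs M \<Longrightarrow>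
    differential M (\<lambda>x. f x + g x) p = (\<lambda>X. differential M f p X + differential M g p X)"
  by (rule ext) (simp add: differential_def, simp add: tangent_space_def)

text \<open>The second slot of the bivector is only ever filled with a differential, hence with a
  covector, where additivity in the first slot holds. On functions that are not smooth both sides
  are 0.\<close>

lemma sharp_add:
  assumes "bivector_field M \<pi>" "p \<in> points M" "\<alpha> \<in> cotangent_space M p" "\<beta> \<in> cotangent_space M p"
  shows "sharp M \<pi> p (\<lambda>X. \<alpha> X + \<beta> X) = (\<lambda>f. sharp M \<pi> p \<alpha> f + sharp M \<pi> p \<beta> f)"
proof
  fix f
  have "\<pi> p (\<lambda>X. \<alpha> X + \<beta> X) \<gamma> = \<pi> p \<alpha> \<gamma> + \<pi> p \<beta> \<gamma>" if "\<gamma> \<in> cotangent_space M p" for \<gamma>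
    using assms that unfolding bivector_field_def by blast
  then show "sharp M \<pi> p (\<lambda>X. \<alpha> X + \<beta> X) f = sharp M \<pi> p \<alpha> f + sharp M \<pi> p \<beta> f"
    by (simp add: sharp_def differential_in_cotangent_space)
qed

lemma sharp_cmult:
  assumes "bivector_field M \<pi>" "p \<in> points M" "\<alpha> \<in> cotangent_space M p"
  shows "sharp M \<pi> p (\<lambda>X. a * \<alpha> X) = (\<lambda>f. a * sharp M \<pi> p \<alpha> f)"
proof
  fix f
  have "\<pi> p (\<lambda>X. a * \<alpha> X) \<gamma> = a * \<pi> p \<alpha> \<gamma>" if "\<gamma> \<in> cotangent_space M p" for \<gamma>
    using assms that unfolding bivector_field_def by blast
  then show "sharp M \<pi> p (\<lambda>X. a * \<alpha> X) f = a * sharp M \<pi> p \<alpha> f"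
    by (simp add: sharp_def differential_in_cotangent_space)
qed

lemma sharp_augmented_hamiltonian:
  assumes "smooth_manifold M" "bivector_field M \<pi>" "p \<in> points M"
    and H: "H \<in> smooth_funs M" and J: "J \<in> smooth_funs M"
  shows "sharp M \<pi> p (differential M (augmented_hamiltonian H J \<xi>) p) =
    (\<lambda>f. hamiltonian_vf M \<pi> H p f - sharp M \<pi> p (differential M (momentum_component J \<xi>) p) f)"
proof -
  note dc = differential_in_cotangent_space
  \<comment> \<open>Written as a sum with the factor \<open>- \<xi>\<close>, the difference is
    covered by the rules for sums and multiples.\<close>
  have "augmented_hamiltonian H J \<xi> = (\<lambda>x. H x + (- \<xi>) * J x)"
    by (simp add: augmented_hamiltonian_def momentum_component_def)
  then have "differential M (augmented_hamiltonian H J \<xi>) p =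
      (\<lambda>X. differential M H p X + (- \<xi>) * differential M J p X)"
    using differential_add[OF H smooth_funs_cmult[OF assms(1) J]] differential_cmult[OF J]
    by (simp only:)
  then have "sharp M \<pi> p (differential M (augmented_hamiltonian H J \<xi>) p) =
      (\<lambda>f. sharp M \<pi> p (differential M H p) f + (- \<xi>) * sharp M \<pi> p (differential M J p) f)"
    by (simp only: sharp_add[OF assms(2,3) dc cotangent_space_cmult[OF dc]]
        sharp_cmult[OF assms(2,3) dc])
  moreover have "sharp M \<pi> p (differential M (momentum_component J \<xi>) p) =
      (\<lambda>f. \<xi> * sharp M \<pi> p (differential M J p) f)"
    by (simp only: momentum_component_def differential_cmult[OF J] sharp_cmult[OF assms(2,3) dc])
  ultimately show ?thesis
    by (simp add: hamiltonian_vf_def)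
qed

theorem proposition4p1:
  fixes M :: "('m, 'e::real_normed_vector) mfd"
    and \<pi> :: "'m \<Rightarrow> 'm bivec"
    and D :: "'m \<Rightarrow> 'm tvec"
    and \<Phi> :: "real \<Rightarrow> 'm \<Rightarrow> 'm"
    and J H :: "'m \<Rightarrow> real"
    and b c :: real
    and z\<^sub>e :: 'm
  assumes "exact_poisson_manifold M \<pi> D"
    and "conformally_poisson M \<pi> \<Phi> c"
    and "conformal_momentum_map M \<pi> D \<Phi> c J"
    and "H \<in> smooth_funs M"
    and "conformally_invariant M \<Phi> H b"
    and "z\<^sub>e \<in> points M"
  shows "conformal_relative_equilibrium M \<pi> \<Phi> H z\<^sub>e \<longleftrightarrow>
    (\<exists>\<xi>. conf_hamiltonian_vf M \<pi> D c J H \<xi> z\<^sub>e = (\<lambda>f. 0))"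
proof -
  have "smooth_manifold M" "bivector_field M \<pi>" and J: "J \<in> smooth_funs M"
    using assms(1,3)
    by (auto simp: exact_poisson_manifold_def poisson_manifold_def conformal_momentum_map_def)
  note aug = sharp_augmented_hamiltonian[OF this(1,2) assms(6,4) J]
  have gen: "infinitesimal_generator M \<Phi> \<xi> z\<^sub>e =
      (\<lambda>f. sharp M \<pi> z\<^sub>e (differential M (momentum_component J \<xi>) z\<^sub>e) f + (c * \<xi>) * D z\<^sub>e f)" for \<xi>
    using assms(3,6) unfolding conformal_momentum_map_def by blast
  \<comment> \<open>The terms in \<open>J\<close> and \<open>D\<close> combine into the generator of
    the same \<xi>, so each witness serves for both directions.\<close>
  have "conf_hamiltonian_vf M \<pi> D c J H \<xi> z\<^sub>e =
      (\<lambda>f. hamiltonian_vf M \<pi> H z\<^sub>e f - infinitesimal_generator M \<Phi> \<xi> z\<^sub>e f)" for \<xi>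
    by (simp add: conf_hamiltonian_vf_def aug gen algebra_simps)
  then show ?thesis
    by (simp add: conformal_relative_equilibrium_def fun_eq_iff)
qed

end
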